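(* Fix $z_0>0$ and $C\in[C_-,C_+]$. There exist $\rho=\rho(C,z_0)<1$ and constants $K_1,K_2$, independent of $\lambda$, $\Delta t$, $n$ and $\phi$, such that, whenever $z=\lambda\Delta t\le-z_0$, the error $e_n=y^n-\phi(t_n)$ of the method applied to $y'=\lambda(y-\phi(t))+\phi'(t)$ with $\lambda<0$, $\phi\in C^6([0,T])$, satisfies for $t_n=n\Delta t\le T$ $$|e_n|\le\rho^n|e_0|+\frac{K_1}{1-\rho}\,\frac{\Delta t^3}{|\lambda|^2}\max_{0\le t\le t_n}|\phi^{(5)}(t)|+\frac{K_2}{1-\rho}\,\Delta t^6\max_{0\le t\le t_n}|\phi^{(6)}(t)|.$$ Thus, with exact starting data $e_0=0$, the error obeys the effective third-order global bound given by the last two terms as long as $|\lambda|\Delta t\ge z_0$. At fixed $\lambda$ and with exact starting data, the classical fourth-order global estimate $\max_{t_n\le T}|e_n|=O(\Delta t^4)$ holds as $\Delta t\to0$.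
   Context: Set $C_\pm=\frac{25\pm\sqrt{105}}{780}$, $a_0=\frac16+\frac72C$, $a_1=\frac23-10C$, $a_2=\frac16+\frac{13}{2}C$. For the problem $y'=F(t,y):=\lambda(y-\phi(t))+\phi'(t)$, the derivative of $F$ along trajectories is $\dot F(t,y)=\lambda^2(y-\phi(t))+\phi''(t)$. With $t_n=n\Delta t$ and $t_{n+1/2}=t_n+\Delta t/2$, write $F_n=F(t_n,y^n)$, $F_\star=F(t_{n+1/2},y^\star)$, $F_{n+1}=F(t_{n+1},y^{n+1})$, and similarly $\dot F_n,\dot F_\star,\dot F_{n+1}$. One step of the method consists of the two (linear, scalar) implicit equations, solved exactly and successively for $y^\star$ and $y^{n+1}$: $$y^\star=y^n+\tfrac{\Delta t}{4}(F_n+F_\star)+\tfrac{\Delta t^2}{48}(\dot F_n-\dot F_\star),$$ $$y^{n+1}=y^n+\Delta t\,(a_0F_n+a_1F_\star+a_2F_{n+1})+C\Delta t^2\bigl(\dot F_n-\dot F_\star-\tfrac32\dot F_{n+1}\bigr).$$ *)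

theory Defs
  imports "HOL-Analysis.Analysis" "HOL-Library.Landau_Symbols"
begin

text \<open>Derivatives are taken within \<open>{0..T}\<close>, hence one-sided at the end points.
  For \<open>T > 0\<close> they are unique, and \<^const>\<open>vector_derivative\<close> selects them.\<close>

definition nderiv :: "real \<Rightarrow> nat \<Rightarrow> (real \<Rightarrow> real) \<Rightarrow> real \<Rightarrow> real" where
  "nderiv T k f = ((\<lambda>g t. vector_derivative g (at t within {0..T})) ^^ k) f"

definition Ck_on :: "nat \<Rightarrow> real \<Rightarrow> (real \<Rightarrow> real) \<Rightarrow> bool" where
  "Ck_on k T f \<longleftrightarrow>
     (\<forall>j<k. nderiv T j f differentiable_on {0..T}) \<and> continuous_on {0..T} (nderiv T k f)"

definition C_minus :: real where "C_minus = (25 - sqrt 105) / 780"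
definition C_plus :: real where "C_plus = (25 + sqrt 105) / 780"

definition coeff_a0 :: "real \<Rightarrow> real" where "coeff_a0 C = 1/6 + 7/2 * C"
definition coeff_a1 :: "real \<Rightarrow> real" where "coeff_a1 C = 2/3 - 10 * C"
definition coeff_a2 :: "real \<Rightarrow> real" where "coeff_a2 C = 1/6 + 13/2 * C"

definition rhs :: "real \<Rightarrow> real \<Rightarrow> (real \<Rightarrow> real) \<Rightarrow> real \<Rightarrow> real \<Rightarrow> real" where
  "rhs T lam \<phi> t y = lam * (y - \<phi> t) + nderiv T 1 \<phi> t"

text \<open>The derivative of \<^const>\<open>rhs\<close> along trajectories, \<open>\<partial>\<^sub>t F + F \<cdot> \<partial>\<^sub>y F\<close>.\<close>

definition rhs_dot :: "real \<Rightarrow> real \<Rightarrow> (real \<Rightarrow> real) \<Rightarrow> real \<Rightarrow> real \<Rightarrow> real" where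
  "rhs_dot T lam \<phi> t y = lam\<^sup>2 * (y - \<phi> t) + nderiv T 2 \<phi> t"

text \<open>One step of size \<open>h\<close> from time \<open>t\<close>, relating the old value \<open>y0\<close>, the stage \<open>ys\<close>
  at time \<open>t + h/2\<close> and the new value \<open>y1\<close>.\<close>

definition method_step ::
  "real \<Rightarrow> real \<Rightarrow> real \<Rightarrow> (real \<Rightarrow> real) \<Rightarrow> real \<Rightarrow> real \<Rightarrow> real \<Rightarrow> real \<Rightarrow> real \<Rightarrow> bool" where
  "method_step C T lam \<phi> h t y0 ys y1 \<longleftrightarrow>
     ys = y0 + h/4 * (rhs T lam \<phi> t y0 + rhs T lam \<phi> (t + h/2) ys)
             + h\<^sup>2/48 * (rhs_dot T lam \<phi> t y0 - rhs_dot T lam \<phi> (t + h/2) ys) \<and>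
     y1 = y0 + h * (coeff_a0 C * rhs T lam \<phi> t y0
                    + coeff_a1 C * rhs T lam \<phi> (t + h/2) ys
                    + coeff_a2 C * rhs T lam \<phi> (t + h) y1)
             + C * h\<^sup>2 * (rhs_dot T lam \<phi> t y0 - rhs_dot T lam \<phi> (t + h/2) ys
                    - 3/2 * rhs_dot T lam \<phi> (t + h) y1)"

text \<open>Only steps that stay inside \<open>[0, T]\<close> are taken, so \<open>y n\<close> is constrained only
  for \<open>n * h \<le> T\<close>.\<close>

definition method_solution ::
  "real \<Rightarrow> real \<Rightarrow> real \<Rightarrow> (real \<Rightarrow> real) \<Rightarrow> real \<Rightarrow> (nat \<Rightarrow> real) \<Rightarrow> bool" where
  "method_solution C T lam \<phi> h y \<longleftrightarrow>
     (\<forall>n. real (Suc n) * h \<le> T \<longrightarrow>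
        (\<exists>ys. method_step C T lam \<phi> h (real n * h) (y n) ys (y (Suc n))))"

definition err :: "(real \<Rightarrow> real) \<Rightarrow> real \<Rightarrow> (nat \<Rightarrow> real) \<Rightarrow> nat \<Rightarrow> real" where
  "err \<phi> h y n = y n - \<phi> (real n * h)"

text \<open>The implicit equations of a step are uniquely solvable, so \<^const>\<open>method_solution\<close>
  determines the numerical solution from its initial value.\<close>

lemma linear_fixpoint_ex1:
  fixes a b :: real
  assumes "a \<noteq> 1"
  shows "\<exists>!x. x = a * x + b"
proof (rule ex1I)
  have "1 - a \<noteq> 0" using assms by simp
  then show "b / (1 - a) = a * (b / (1 - a)) + b" by (simp add: field_simps)
  fix x assume "x = a * x + b"
  then have "x * (1 - a) = b" by (simp add: algebra_simps)
  then show "x = b / (1 - a)" using \<open>1 - a \<noteq> 0\<close> by (simp add: eq_divide_eq)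
qed

lemma method_step_ex1:
  assumes "0 < h" "lam < 0" "0 \<le> C"
  shows "\<exists>!(ys, y1). method_step C T lam \<phi> h t y0 ys y1"
proof -
  define z where "z = lam * h"
  have z: "z < 0" using assms by (simp add: z_def mult_neg_pos)
  define a where "a = z/4 - z\<^sup>2/48"
  define b where "b = y0 + h/4 * (rhs T lam \<phi> t y0 + rhs T lam \<phi> (t + h/2) 0)
     + h\<^sup>2/48 * (rhs_dot T lam \<phi> t y0 - rhs_dot T lam \<phi> (t + h/2) 0)"
  define c where "c = coeff_a2 C * z - 3/2 * C * z\<^sup>2"
  define d where "d ys = y0 + h * (coeff_a0 C * rhs T lam \<phi> t y0
       + coeff_a1 C * rhs T lam \<phi> (t + h/2) ys + coeff_a2 C * rhs T lam \<phi> (t + h) 0)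
     + C * h\<^sup>2 * (rhs_dot T lam \<phi> t y0 - rhs_dot T lam \<phi> (t + h/2) ys
       - 3/2 * rhs_dot T lam \<phi> (t + h) 0)" for ys
  have rhs_affine: "rhs T lam \<phi> s x = lam * x + rhs T lam \<phi> s 0"
    and rhs_dot_affine: "rhs_dot T lam \<phi> s x = lam\<^sup>2 * x + rhs_dot T lam \<phi> s 0" for T lam \<phi> s x
    by (simp_all add: rhs_def rhs_dot_def right_diff_distrib)
  have step: "method_step C T lam \<phi> h t y0 ys y1 \<longleftrightarrow> ys = a * ys + b \<and> y1 = c * y1 + d ys"
    for ys y1
  proof -
    have 1: "y0 + h/4 * (rhs T lam \<phi> t y0 + rhs T lam \<phi> (t + h/2) ys)
             + h\<^sup>2/48 * (rhs_dot T lam \<phi> t y0 - rhs_dot T lam \<phi> (t + h/2) ys) = a * ys + b"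
      unfolding a_def b_def z_def rhs_affine[of T lam \<phi> "t + h/2" ys]
        rhs_dot_affine[of T lam \<phi> "t + h/2" ys] by algebra
    have 2: "y0 + h * (coeff_a0 C * rhs T lam \<phi> t y0
                    + coeff_a1 C * rhs T lam \<phi> (t + h/2) ys
                    + coeff_a2 C * rhs T lam \<phi> (t + h) y1)
             + C * h\<^sup>2 * (rhs_dot T lam \<phi> t y0 - rhs_dot T lam \<phi> (t + h/2) ys
                    - 3/2 * rhs_dot T lam \<phi> (t + h) y1) = c * y1 + d ys"
      unfolding c_def d_def z_def rhs_affine[of T lam \<phi> "t + h" y1]
        rhs_dot_affine[of T lam \<phi> "t + h" y1] by algebra
    show ?thesis unfolding method_step_def 1 2 ..
  qed
  have "a < 0"
    using z zero_le_power2[of z] unfolding a_def by linarith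
  then have ex1: "\<exists>!ys. ys = a * ys + b" by (intro linear_fixpoint_ex1) simp
  have "coeff_a2 C * z < 0" "0 \<le> C * z\<^sup>2"
    using z assms by (simp_all add: coeff_a2_def mult_pos_neg)
  then have "c < 0" unfolding c_def by linarith
  then have ex2: "\<exists>!y1. y1 = c * y1 + d ys" for ys by (intro linear_fixpoint_ex1) simp
  define ys where "ys = (THE x. x = a * x + b)"
  define y1 where "y1 = (THE x. x = c * x + d ys)"
  note ys = theI'[OF ex1, folded ys_def] and ys_uniq = the1_equality[OF ex1, folded ys_def]
  note y1 = theI'[OF ex2[of ys], folded y1_def]
    and y1_uniq = the1_equality[OF ex2[of ys], folded y1_def]
  show ?thesis
  proof (rule ex1I[of _ "(ys, y1)"])
    show "case (ys, y1) of (ys, y1) \<Rightarrow> method_step C T lam \<phi> h t y0 ys y1"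
      unfolding prod.case step by (rule conjI[OF ys y1])
  next
    fix p assume p: "case p of (ys, y1) \<Rightarrow> method_step C T lam \<phi> h t y0 ys y1"
    obtain u v where uv: "p = (u, v)" by (cases p)
    have u: "u = a * u + b" and v: "v = c * v + d u"
      using p unfolding uv prod.case step by (rule conjunct1, rule conjunct2)
    have "ys = u" by (rule ys_uniq[OF u])
    with v have "v = c * v + d ys" by (simp only:)
    then have "y1 = v" by (rule y1_uniq)
    with \<open>ys = u\<close> uv show "p = (ys, y1)" by (simp only:)
  qed
qed

end

theory Submission
  imports Defs
begin

text \<open>With \<open>z = \<lambda> h\<close> the errors of a step satisfy \<open>D Q e\<^sub>1 = N e\<^sub>0 + (a\<^sub>1 z - C z\<^sup>2) d\<^sub>1 + Q d\<^sub>2\<close>,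
  where \<open>Q\<close> and \<open>D\<close> are the denominators of the two implicit equations, \<open>N / (D Q)\<close> is the
  stability function, and the defects \<open>d\<^sub>1\<close>, \<open>d\<^sub>2\<close> of the quadrature formulas are
  \<open>O(h\<^sup>5 max \<bar>\<phi>\<^sup>(\<^sup>5\<^sup>)\<bar>)\<close>. For \<open>C\<close> in the given range, \<open>D Q - N\<close> and \<open>D Q + N\<close> are polynomials in
  \<open>-z\<close> with nonnegative coefficients, which bounds the stability function away from
  \<open>1\<close> in absolute value when \<open>z \<le> -z\<^sub>0\<close>. Since \<open>Q\<close> and \<open>D\<close> are at least
  \<open>1\<close> and grow like \<open>z\<^sup>2\<close>, the defects contribute at most a multiple of \<open>h\<^sup>5\<close> and
  of \<open>h\<^sup>5 / z\<^sup>2 = h\<^sup>3 / \<lambda>\<^sup>2\<close> per step; summing gives both bounds, the first one with \<open>K\<^sub>2 = 0\<close>.\<close>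

section \<open>Taylor expansion\<close>

lemma nderiv_0: "nderiv T 0 f = f"
  by (simp add: nderiv_def)

lemma has_vector_derivative_nderiv:
  assumes "Ck_on k T f" "j < k" "t \<in> {0..T}"
  shows "(nderiv T j f has_vector_derivative nderiv T (Suc j) f t) (at t within {0..T})"
proof -
  have "nderiv T j f differentiable (at t within {0..T})"
    using assms by (auto simp: Ck_on_def differentiable_on_def)
  then show ?thesis
    by (simp add: vector_derivative_works nderiv_def)
qed

lemma continuous_on_nderiv:
  assumes "Ck_on k T f" "j \<le> k"
  shows "continuous_on {0..T} (nderiv T j f)"
  using assms by (cases "j = k") (auto simp: Ck_on_def intro: differentiable_imp_continuous_on)

lemma bdd_above_abs_nderiv:
  assumes "Ck_on k T f" "j \<le> k" "s \<le> T"
  shows "bdd_above ((\<lambda>t. \<bar>nderiv T j f t\<bar>) ` {0..s})"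
proof -
  have "continuous_on {0..s} (\<lambda>t. \<bar>nderiv T j f t\<bar>)"
    using continuous_on_nderiv[OF assms(1,2)] assms(3)
    by (intro continuous_on_rabs) (auto elim: continuous_on_subset)
  then show ?thesis
    by (intro bounded_imp_bdd_above compact_imp_bounded compact_continuous_image) auto
qed

lemma abs_nderiv_le_SUP:
  assumes "Ck_on k T f" "j \<le> k" "s \<le> T" "0 \<le> t" "t \<le> s"
  shows "\<bar>nderiv T j f t\<bar> \<le> (SUP t\<in>{0..s}. \<bar>nderiv T j f t\<bar>)"
  using assms by (intro cSUP_upper bdd_above_abs_nderiv[of k]) auto

text \<open>The integral form of the remainder is used. Its kernel \<open>(b - x) ^ (p - 1)\<close>
  is replaced by its maximum instead of being integrated, hence \<open>fact (p - 1)\<close> where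
  the sharp bound has \<open>fact p\<close>.\<close>

lemma Taylor_nderiv_bound:
  assumes f: "Ck_on k T f" and m: "m = j + p" "m \<le> k" "0 < p"
    and ab: "0 \<le> a" "a \<le> b" "b \<le> T"
    and M: "\<And>t. \<lbrakk>a \<le> t; t \<le> b\<rbrakk> \<Longrightarrow> \<bar>nderiv T m f t\<bar> \<le> M"
  shows "\<bar>nderiv T j f b - (\<Sum>i<p. (b - a) ^ i / fact i * nderiv T (j + i) f a)\<bar>
           \<le> M * (b - a) ^ p / fact (p - 1)"
proof -
  have M0: "0 \<le> M" using M[of a] ab by (smt (verit))
  have I: "((\<lambda>x. ((b - x) ^ (p - 1) / fact (p - 1)) *\<^sub>R nderiv T (j + p) f x) has_integral
      nderiv T j f b - (\<Sum>i<p. ((b - a) ^ i / fact i) *\<^sub>R nderiv T (j + i) f a)) {a..b}"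
  proof (rule Taylor_has_integral)
    fix i t assume "i < p" "a \<le> t" "t \<le> b"
    then have "(nderiv T (j + i) f has_vector_derivative nderiv T (Suc (j + i)) f t)
                 (at t within {0..T})"
      using m ab by (intro has_vector_derivative_nderiv[OF f]) auto
    then show "(nderiv T (j + i) f has_vector_derivative nderiv T (j + Suc i) f t)
                 (at t within {a..b})"
      using ab by (auto elim: has_vector_derivative_within_subset)
  qed (use m ab in auto)
  have "norm (nderiv T j f b - (\<Sum>i<p. ((b - a) ^ i / fact i) *\<^sub>R nderiv T (j + i) f a))
          \<le> ((b - a) ^ (p - 1) / fact (p - 1) * M) * measure lborel {a..b}"
  proof (rule has_integral_bound_real[OF _ finite.emptyI I])
    show "0 \<le> (b - a) ^ (p - 1) / fact (p - 1) * M" using ab M0 by simp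
    fix x assume "x \<in> {a..b} - {}"
    then show "norm (((b - x) ^ (p - 1) / fact (p - 1)) *\<^sub>R nderiv T (j + p) f x)
        \<le> (b - a) ^ (p - 1) / fact (p - 1) * M"
      using M[of x] m by (auto simp: abs_mult intro!: mult_mono divide_right_mono power_mono)
  qed
  moreover have "(b - a) ^ p = (b - a) ^ (p - 1) * (b - a)"
    using \<open>0 < p\<close> by (metis power_minus_mult)
  ultimately show ?thesis using ab by (simp add: mult_ac)
qed

section \<open>Defects\<close>

text \<open>Residual of the exact solution in the stage equation: at \<open>y = \<phi> t\<close>,
  \<open>rhs\<close> and \<open>rhs_dot\<close> reduce to the first and second derivative of
  \<open>\<phi>\<close>. Likewise \<open>step_defect\<close> for the second equation.\<close>

definition stage_defect :: "real \<Rightarrow> (real \<Rightarrow> real) \<Rightarrow> real \<Rightarrow> real \<Rightarrow> real" where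
  "stage_defect T \<phi> h t = \<phi> t - \<phi> (t + h/2)
     + h/4 * (nderiv T 1 \<phi> t + nderiv T 1 \<phi> (t + h/2))
     + h\<^sup>2/48 * (nderiv T 2 \<phi> t - nderiv T 2 \<phi> (t + h/2))"

definition step_defect :: "real \<Rightarrow> real \<Rightarrow> (real \<Rightarrow> real) \<Rightarrow> real \<Rightarrow> real \<Rightarrow> real" where
  "step_defect C T \<phi> h t = \<phi> t - \<phi> (t + h)
     + h * (coeff_a0 C * nderiv T 1 \<phi> t + coeff_a1 C * nderiv T 1 \<phi> (t + h/2)
            + coeff_a2 C * nderiv T 1 \<phi> (t + h))
     + C * h\<^sup>2 * (nderiv T 2 \<phi> t - nderiv T 2 \<phi> (t + h/2) - 3/2 * nderiv T 2 \<phi> (t + h))"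

text \<open>The surd end points are relaxed to nearby rationals, so that later conditions on
  \<open>C\<close> become linear arithmetic.\<close>

lemma C_bounds:
  assumes "C \<in> {C_minus..C_plus}"
  shows "189/10000 \<le> C" "C \<le> 452/10000"
proof -
  have "sqrt 105 \<le> 10.25" by (rule real_le_lsqrt) (auto simp: power2_eq_square)
  then show "189/10000 \<le> C" "C \<le> 452/10000"
    using assms unfolding C_minus_def C_plus_def by auto
qed

lemma abs_affine_comb2_le:
  fixes a b x y :: real
  assumes "\<bar>x\<bar> \<le> X" "\<bar>y\<bar> \<le> Y" "\<bar>a\<bar> \<le> A" "\<bar>b\<bar> \<le> B"
  shows "\<bar>a * x + b * y\<bar> \<le> A * X + B * Y"
proof -
  have "\<bar>a * x\<bar> \<le> A * X" "\<bar>b * y\<bar> \<le> B * Y"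
    using assms by (auto simp: abs_mult intro!: mult_mono intro: order_trans[OF abs_ge_zero])
  then show ?thesis by linarith
qed

text \<open>Both formulas are exact for polynomials of degree at most 4. Expanding
  \<open>\<phi>\<close> and its first two derivatives about \<open>t\<close> thus leaves only
  remainders, which the powers of \<open>h\<close> in the formulas bring to the common order
  \<open>h^5\<close>.\<close>

lemma defect_bounds:
  assumes \<phi>: "Ck_on 6 T \<phi>" and t: "0 \<le> t" "0 < h" "t + h \<le> T"
    and M: "\<And>s. \<lbrakk>t \<le> s; s \<le> t + h\<rbrakk> \<Longrightarrow> \<bar>nderiv T 5 \<phi> s\<bar> \<le> M"
    and C: "189/10000 \<le> C" "C \<le> 452/10000"
  shows "\<bar>stage_defect T \<phi> h t\<bar> \<le> M * h ^ 5" "\<bar>step_defect C T \<phi> h t\<bar> \<le> M * h ^ 5"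
proof -
  define p where "p k = nderiv T k \<phi> t" for k
  define r0 where "r0 s = \<phi> (t + s) - (p 0 + s * p 1 + s^2/2 * p 2 + s^3/6 * p 3 + s^4/24 * p 4)" for s
  define r1 where "r1 s = nderiv T 1 \<phi> (t + s) - (p 1 + s * p 2 + s^2/2 * p 3 + s^3/6 * p 4)" for s
  define r2 where "r2 s = nderiv T 2 \<phi> (t + s) - (p 2 + s * p 3 + s^2/2 * p 4)" for s
  have r: "\<bar>r0 s\<bar> \<le> M * s^5 / 24" "\<bar>r1 s\<bar> \<le> M * s^4 / 6" "\<bar>r2 s\<bar> \<le> M * s^3 / 2"
    if s: "0 \<le> s" "s \<le> h" for s
  proof -
    have T: "\<bar>nderiv T j \<phi> (t + s) - (\<Sum>i<p. (t + s - t) ^ i / fact i * nderiv T (j + i) \<phi> t)\<bar>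
           \<le> M * (t + s - t) ^ p / fact (p - 1)" if "5 = j + p" "0 < p" for j p
      by (rule Taylor_nderiv_bound[OF \<phi>, of 5]) (use s t M that in auto)
    show "\<bar>r0 s\<bar> \<le> M * s^5 / 24" "\<bar>r1 s\<bar> \<le> M * s^4 / 6" "\<bar>r2 s\<bar> \<le> M * s^3 / 2"
      \<comment> \<open>Expanding the derivative of order \<open>j\<close> to \<open>5 - j\<close>
        terms always leaves the fifth derivative in the remainder.\<close>
      using T[of 0 5] T[of 1 4] T[of 2 3]
      by (simp_all add: r0_def r1_def r2_def p_def eval_nat_numeral fact_numeral nderiv_0)
  qed
  have M0: "0 \<le> M" using M[of t] t by (smt (verit))
  have h: "0 \<le> h/2" "h/2 \<le> h" "0 \<le> h" "h \<le> h" using t by auto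
  note rh = r[OF h(1,2)] r[OF h(3,4)]
  have Mh: "0 \<le> M * h^5" using M0 t by simp
  have mono: "\<bar>h * x\<bar> \<le> M * h^5 * c" if "\<bar>x\<bar> \<le> M * h^4 * c" for x c
  proof -
    have "h * \<bar>x\<bar> \<le> h * (M * h^4 * c)" using that t by (intro mult_left_mono) auto
    then show ?thesis using t by (simp add: abs_mult eval_nat_numeral mult_ac)
  qed
  have mono2: "\<bar>h\<^sup>2 * x\<bar> \<le> M * h^5 * c" if "\<bar>x\<bar> \<le> M * h^3 * c" for x c
  proof -
    have "h\<^sup>2 * \<bar>x\<bar> \<le> h\<^sup>2 * (M * h^3 * c)" using that t by (intro mult_left_mono) auto
    then show ?thesis using t by (simp add: abs_mult eval_nat_numeral mult_ac)
  qed
  have b: "\<bar>r0 (h/2)\<bar> \<le> M * h^5 * (1/768)" "\<bar>r0 h\<bar> \<le> M * h^5 * (1/24)"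
    "\<bar>h * r1 (h/2)\<bar> \<le> M * h^5 * (1/96)" "\<bar>h * r1 h\<bar> \<le> M * h^5 * (1/6)"
    "\<bar>h\<^sup>2 * r2 (h/2)\<bar> \<le> M * h^5 * (1/16)" "\<bar>h\<^sup>2 * r2 h\<bar> \<le> M * h^5 * (1/2)"
    using rh by (simp_all only: power_divide) (intro mono mono2 | simp)+
  have "stage_defect T \<phi> h t = - r0 (h/2) + 1/4 * (h * r1 (h/2)) - 1/48 * (h\<^sup>2 * r2 (h/2))"
    unfolding stage_defect_def r0_def r1_def r2_def p_def nderiv_0
    by (simp add: field_simps eval_nat_numeral)
  then show "\<bar>stage_defect T \<phi> h t\<bar> \<le> M * h ^ 5"
    using b Mh by linarith
  have "step_defect C T \<phi> h t = - r0 h + (coeff_a1 C * (h * r1 (h/2)) + coeff_a2 C * (h * r1 h))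
      - (C * (h\<^sup>2 * r2 (h/2)) + (3/2 * C) * (h\<^sup>2 * r2 h))"
    unfolding step_defect_def r0_def r1_def r2_def p_def nderiv_0 coeff_a0_def coeff_a1_def coeff_a2_def
    by (simp add: field_simps eval_nat_numeral)
  \<comment> \<open>All weights are at most 1 in absolute value for these \<open>C\<close>, and 1/24
    + 1/96 + 1/6 + 1/16 + 1/2 is below 1.\<close>
  moreover have "\<bar>coeff_a1 C * (h * r1 (h/2)) + coeff_a2 C * (h * r1 h)\<bar>
      \<le> 1 * (M * h^5 * (1/96)) + 1 * (M * h^5 * (1/6))"
    by (rule abs_affine_comb2_le[OF b(3,4)]) (use C in \<open>auto simp: coeff_a1_def coeff_a2_def\<close>)
  moreover have "\<bar>C * (h\<^sup>2 * r2 (h/2)) + (3/2 * C) * (h\<^sup>2 * r2 h)\<bar>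
      \<le> 1 * (M * h^5 * (1/16)) + 1 * (M * h^5 * (1/2))"
    by (rule abs_affine_comb2_le[OF b(5,6)]) (use C in auto)
  ultimately show "\<bar>step_defect C T \<phi> h t\<bar> \<le> M * h ^ 5"
    using b(2) Mh by linarith
qed

section \<open>Stability\<close>

definition stage_denom :: "real \<Rightarrow> real" where
  "stage_denom z = 1 - z/4 + z\<^sup>2/48"

definition step_denom :: "real \<Rightarrow> real \<Rightarrow> real" where
  "step_denom C z = 1 - coeff_a2 C * z + 3/2 * C * z\<^sup>2"

text \<open>Outcome of eliminating the stage error: the old error enters directly, and through the
  stage with the factor \<open>(1 + z/4 + z\<^sup>2/48) / stage_denom z\<close>.\<close>

definition stab_num :: "real \<Rightarrow> real \<Rightarrow> real" where
  "stab_num C z = (1 + coeff_a0 C * z + C * z\<^sup>2) * stage_denom z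
     + (coeff_a1 C * z - C * z\<^sup>2) * (1 + z/4 + z\<^sup>2/48)"

text \<open>For negative \<open>z\<close> no term of either denominator is negative, so each
  dominates its constant and its quadratic term. The constant bounds serve the classical estimate,
  the quadratic ones the stiff estimate.\<close>

lemma denom_ge:
  assumes "z < 0" "189/10000 \<le> C"
  shows "1 \<le> stage_denom z" "1 \<le> step_denom C z"
    "z\<^sup>2/48 \<le> stage_denom z" "z\<^sup>2/40 \<le> step_denom C z"
proof -
  have "coeff_a2 C * z \<le> 0"
    using assms by (intro mult_nonneg_nonpos) (auto simp: coeff_a2_def)
  moreover have "z\<^sup>2/40 \<le> 3/2 * C * z\<^sup>2"
    using mult_right_mono[of "1/40" "3/2 * C" "z\<^sup>2"] assms by simp
  moreover have "0 \<le> z\<^sup>2" by simp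
  ultimately show "1 \<le> step_denom C z" "z\<^sup>2/40 \<le> step_denom C z"
    unfolding step_denom_def by linarith+
  show "1 \<le> stage_denom z" "z\<^sup>2/48 \<le> stage_denom z"
    using assms \<open>0 \<le> z\<^sup>2\<close> unfolding stage_denom_def by linarith+
qed

text \<open>With \<open>S\<close> the sum of the first four powers of \<open>x = - z\<close>, both
  gaps \<open>W - stab_num C z\<close> and \<open>W + stab_num C z\<close> are at least
  \<open>S / 2000\<close>, while \<open>W \<le> 1 + S\<close>. The ratio \<open>S / (1 + S)\<close>
  increases with \<open>S\<close>, and \<open>S\<close> is at least \<open>z0\<close>.\<close>

lemma stab_num_le:
  assumes z: "0 < z0" "z \<le> - z0" and C: "189/10000 \<le> C" "C \<le> 452/10000"
  shows "\<bar>stab_num C z\<bar> \<le> (1 - z0 / (2000 * (1 + z0))) * (step_denom C z * stage_denom z)"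
proof -
  define x where "x = - z"
  define W where "W = step_denom C z * stage_denom z"
  define S where "S = x + x^2 + x^3 + x^4"
  have x: "0 < x" "z0 \<le> x" and zx: "z = - x" using z by (auto simp: x_def)
  have W: "W = 1 + (5/12 + 13/2 * C) * x + (1/16 + 25/8 * C) * x^2
      + (1/288 + 49/96 * C) * x^3 + C/32 * x^4"
    unfolding W_def step_denom_def stage_denom_def coeff_a2_def zx
    by (simp add: field_simps eval_nat_numeral)
  \<comment> \<open>There is no constant term, since the stability function is 1 at
    \<open>z = 0\<close>. The damping is lost there, which is why the rate depends on
    \<open>z0\<close>.\<close>
  have minus: "W - stab_num C z = x + (13/2 * C - 1/12) * x^2 + (1/48 - C/8) * x^3 + C/32 * x^4"
    unfolding W_def step_denom_def stage_denom_def stab_num_def coeff_a0_def coeff_a1_def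
      coeff_a2_def zx by (simp add: field_simps eval_nat_numeral)
  have plus: "W + stab_num C z = 2 + (13 * C - 1/6) * x + (5/24 - C/4) * x^2
      + (55/48 * C - 1/72) * x^3 + C/32 * x^4"
    unfolding W_def step_denom_def stage_denom_def stab_num_def coeff_a0_def coeff_a1_def
      coeff_a2_def zx by (simp add: field_simps eval_nat_numeral)
  have up: "c * x^k \<le> x^k" if "c \<le> 1" for c k
    using mult_right_mono[OF that, of "x^k"] x by simp
  have low: "x^k / 2000 \<le> c * x^k" if "1/2000 \<le> c" for c k
    using mult_right_mono[OF that, of "x^k"] x by simp
  have "W \<le> 1 + S"
    unfolding W S_def using C up[of "5/12 + 13/2 * C" 1] up[of "1/16 + 25/8 * C" 2]
      up[of "1/288 + 49/96 * C" 3] up[of "C/32" 4] by simp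
  also have "z0 * (1 + S) \<le> S * (1 + z0)"
    using x by (simp add: algebra_simps S_def add_increasing2)
  then have "1 + S \<le> S * (1 + z0) / z0" using z by (simp add: field_simps)
  finally have "z0 / (2000 * (1 + z0)) * W \<le> z0 / (2000 * (1 + z0)) * (S * (1 + z0) / z0)"
    using z by (intro mult_left_mono) auto
  also have "\<dots> = S / 2000"
    using z by (simp add: nonzero_divide_eq_eq[of "1 + z0"] divide_simps)
  finally have gap: "z0 / (2000 * (1 + z0)) * W \<le> S / 2000" .
  have "S / 2000 \<le> W - stab_num C z"
  proof -
    \<comment> \<open>The smallest coefficient in either gap is \<open>C/32\<close>, which exceeds
      1/2000 because \<open>C\<close> is at least 0.0189.\<close>
    have "x^2 / 2000 \<le> (13/2 * C - 1/12) * x^2" "x^3 / 2000 \<le> (1/48 - C/8) * x^3"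
      "x^4 / 2000 \<le> C/32 * x^4" using C by (intro low; simp)+
    then show ?thesis unfolding minus S_def add_divide_distrib using x by linarith
  qed
  moreover have "S / 2000 \<le> W + stab_num C z"
  proof -
    have "x^1 / 2000 \<le> (13 * C - 1/6) * x^1" "x^2 / 2000 \<le> (5/24 - C/4) * x^2"
      "x^3 / 2000 \<le> (55/48 * C - 1/72) * x^3" "x^4 / 2000 \<le> C/32 * x^4"
      using C by (intro low; simp)+
    then show ?thesis unfolding plus S_def add_divide_distrib power_one_right by linarith
  qed
  ultimately have "\<bar>stab_num C z\<bar> \<le> W - z0 / (2000 * (1 + z0)) * W"
    using gap by linarith
  then show ?thesis unfolding W_def by (simp add: left_diff_distrib)
qed

section \<open>Error recursion\<close>

text \<open>Written in the errors, both equations become linear with the defects as inhomogeneities.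
  Multiplying the second by \<open>stage_denom z\<close> lets the first replace the stage error
  without a division.\<close>

lemma method_step_error_eq:
  fixes C T lam h t y0 y1 :: real and \<phi> :: "real \<Rightarrow> real"
  assumes "method_step C T lam \<phi> h t y0 ys y1"
  defines "z \<equiv> lam * h"
  shows "(y1 - \<phi> (t + h)) * (step_denom C z * stage_denom z) =
     stab_num C z * (y0 - \<phi> t) + (coeff_a1 C * z - C * z\<^sup>2) * stage_defect T \<phi> h t
     + step_defect C T \<phi> h t * stage_denom z"
proof -
  define e0 es e1 where "e0 = y0 - \<phi> t" and "es = ys - \<phi> (t + h/2)" and "e1 = y1 - \<phi> (t + h)"
  have y: "y0 = e0 + \<phi> t" "ys = es + \<phi> (t + h/2)" "y1 = e1 + \<phi> (t + h)"
    by (simp_all add: e0_def es_def e1_def)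
  have 1: "es * stage_denom z = (1 + z/4 + z\<^sup>2/48) * e0 + stage_defect T \<phi> h t"
    using assms(1) unfolding y method_step_def rhs_def rhs_dot_def stage_denom_def
      stage_defect_def z_def by (simp add: algebra_simps power2_eq_square)
  have 2: "e1 * step_denom C z = (1 + coeff_a0 C * z + C * z\<^sup>2) * e0
      + (coeff_a1 C * z - C * z\<^sup>2) * es + step_defect C T \<phi> h t"
    using assms(1) unfolding y method_step_def rhs_def rhs_dot_def step_denom_def
      step_defect_def z_def by (simp add: algebra_simps power2_eq_square)
  have "e1 * (step_denom C z * stage_denom z) = (e1 * step_denom C z) * stage_denom z" by simp
  also have "\<dots> = (1 + coeff_a0 C * z + C * z\<^sup>2) * stage_denom z * e0
      + (coeff_a1 C * z - C * z\<^sup>2) * (es * stage_denom z) + step_defect C T \<phi> h t * stage_denom z"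
    unfolding 2 by algebra
  also have "\<dots> = stab_num C z * e0 + (coeff_a1 C * z - C * z\<^sup>2) * stage_defect T \<phi> h t
     + step_defect C T \<phi> h t * stage_denom z"
    unfolding 1 stab_num_def by algebra
  finally show ?thesis unfolding e0_def e1_def .
qed

lemma method_step_error_le:
  fixes C T lam h t y0 y1 :: real and \<phi> :: "real \<Rightarrow> real"
  assumes step: "method_step C T lam \<phi> h t y0 ys y1"
    and z: "z = lam * h" "0 < z0" "z \<le> - z0"
    and \<phi>: "Ck_on 6 T \<phi>" and t: "0 \<le> t" "0 < h" "t + h \<le> T"
    and M: "\<And>s. \<lbrakk>t \<le> s; s \<le> t + h\<rbrakk> \<Longrightarrow> \<bar>nderiv T 5 \<phi> s\<bar> \<le> M"
    and C: "189/10000 \<le> C" "C \<le> 452/10000"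
  shows "\<bar>y1 - \<phi> (t + h)\<bar> \<le> (1 - z0 / (2000 * (1 + z0))) * \<bar>y0 - \<phi> t\<bar>
     + M * h^5 * (4 / stage_denom z + 1 / step_denom C z)"
proof -
  define Q D N d where "Q = stage_denom z" and "D = step_denom C z" and "N = stab_num C z"
    and "d = M * h^5"
  define \<rho> where "\<rho> = 1 - z0 / (2000 * (1 + z0))"
  have z0: "z < 0" using z by simp
  have pos: "0 < Q" "0 < D" using denom_ge[OF z0 C(1)] by (auto simp: Q_def D_def)
  have d1: "\<bar>stage_defect T \<phi> h t\<bar> \<le> d" and d2: "\<bar>step_defect C T \<phi> h t\<bar> \<le> d"
    unfolding d_def by (rule defect_bounds[OF \<phi> t M C]; assumption)+
  have d0: "0 \<le> d" using d1 by linarith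
  \<comment> \<open>Both terms are nonpositive. The factor 4 comes from
    \<open>coeff_a1 C \<le> 4 * coeff_a2 C\<close>; the quadratic term of \<open>4 * D\<close> is
    ample.\<close>
  have a: "\<bar>coeff_a1 C * z - C * z\<^sup>2\<bar> \<le> 4 * D"
  proof -
    have "coeff_a1 C * z \<le> 0" "4 * coeff_a2 C * z \<le> coeff_a1 C * z" "0 \<le> C * z\<^sup>2"
      using C z0
      by (auto simp: coeff_a1_def coeff_a2_def intro: mult_nonneg_nonpos mult_right_mono_neg)
    moreover have "D = 1 - coeff_a2 C * z + 3/2 * (C * z\<^sup>2)"
      by (simp add: D_def step_denom_def)
    ultimately show ?thesis by (intro abs_leI) linarith+
  qed
  have N: "\<bar>N\<bar> \<le> \<rho> * (D * Q)"
    unfolding N_def \<rho>_def D_def Q_def by (rule stab_num_le) (use z C in auto)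
  have "\<bar>y1 - \<phi> (t + h)\<bar> * (D * Q) = \<bar>(y1 - \<phi> (t + h)) * (D * Q)\<bar>"
    using pos by (simp add: abs_mult)
  also have "\<dots> = \<bar>N * (y0 - \<phi> t) + (coeff_a1 C * z - C * z\<^sup>2) * stage_defect T \<phi> h t
     + step_defect C T \<phi> h t * Q\<bar>"
    unfolding D_def Q_def N_def z(1) method_step_error_eq[OF step] ..
  also have "\<dots> \<le> \<bar>N\<bar> * \<bar>y0 - \<phi> t\<bar> + \<bar>coeff_a1 C * z - C * z\<^sup>2\<bar> * \<bar>stage_defect T \<phi> h t\<bar>
     + \<bar>step_defect C T \<phi> h t\<bar> * Q"
    using pos by (intro order_trans[OF abs_triangle_ineq] add_mono) (auto simp: abs_mult)
  also have "\<dots> \<le> \<rho> * (D * Q) * \<bar>y0 - \<phi> t\<bar> + (4 * D) * d + d * Q"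
    using a N d1 d2 pos d0 by (intro add_mono mult_mono mult_right_mono) auto
  also have "\<dots> = (\<rho> * \<bar>y0 - \<phi> t\<bar> + d * (4 / Q + 1 / D)) * (D * Q)"
    using pos by (simp add: field_simps)
  finally show ?thesis
    using pos unfolding \<rho>_def d_def Q_def D_def by (simp only: mult_le_cancel_right_pos mult_pos_pos)
qed

text \<open>Taking the maximum up to time \<open>n * h\<close> gives all steps \<open>k < n\<close>
  the same inhomogeneous term. Leaving \<open>z0\<close> free permits \<open>z0 = - z\<close> in the
  classical case, where \<open>lam * h\<close> may be arbitrarily small.\<close>

lemma err_Suc_le:
  assumes sol: "method_solution C T lam \<phi> h y"
    and z: "z = lam * h" "0 < z0" "z \<le> - z0"
    and \<phi>: "Ck_on 6 T \<phi>" and h: "0 < h" and k: "k < n" "real n * h \<le> T"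
    and M: "M = (SUP t\<in>{0..real n * h}. \<bar>nderiv T 5 \<phi> t\<bar>)"
    and C: "189/10000 \<le> C" "C \<le> 452/10000"
  shows "\<bar>err \<phi> h y (Suc k)\<bar> \<le> (1 - z0 / (2000 * (1 + z0))) * \<bar>err \<phi> h y k\<bar>
     + M * h^5 * (4 / stage_denom z + 1 / step_denom C z)"
proof -
  have kn: "real (Suc k) * h \<le> real n * h" using k h by (intro mult_right_mono) auto
  then have kT: "real (Suc k) * h \<le> T" using k by linarith
  obtain ys where step: "method_step C T lam \<phi> h (real k * h) (y k) ys (y (Suc k))"
    using sol kT unfolding method_solution_def by blast
  have eq: "real k * h + h = real (Suc k) * h" by (simp add: algebra_simps)
  have t0: "0 \<le> real k * h" using h by simp
  show ?thesis
    unfolding err_def eq[symmetric]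
  proof (rule method_step_error_le[OF step z \<phi> t0 h _ _ C])
    show "real k * h + h \<le> T" using kT eq by simp
    show "\<bar>nderiv T 5 \<phi> s\<bar> \<le> M" if "real k * h \<le> s" "s \<le> real k * h + h" for s
      unfolding M
    proof (rule abs_nderiv_le_SUP[OF \<phi> _ k(2)])
      show "0 \<le> s" "s \<le> real n * h" using that kn eq t0 by linarith+
    qed simp
  qed
qed

text \<open>The value \<open>b / (1 - \<rho>)\<close> is the fixed point of
  \<open>x \<mapsto> \<rho> * x + b\<close>, so the bound reproduces itself in each step.\<close>

lemma geometric_recursion_bound:
  fixes E :: "nat \<Rightarrow> real"
  assumes "0 \<le> \<rho>" "\<rho> < 1" "0 \<le> b"
    and step: "\<And>k. k < n \<Longrightarrow> E (Suc k) \<le> \<rho> * E k + b"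
  shows "E n \<le> \<rho> ^ n * E 0 + b / (1 - \<rho>)"
  using step
proof (induction n)
  case 0
  show ?case using assms(1-3) by simp
next
  case (Suc n)
  have "E (Suc n) \<le> \<rho> * E n + b" using Suc.prems by simp
  also have "\<dots> \<le> \<rho> * (\<rho> ^ n * E 0 + b / (1 - \<rho>)) + b"
    using Suc assms(1) by (intro add_right_mono mult_left_mono) auto
  also have "\<dots> = \<rho> ^ Suc n * E 0 + b / (1 - \<rho>)"
    using assms(2) by (simp add: field_simps)
  finally show ?case .
qed

section \<open>Global error bounds in the stiff and the classical regime\<close>

lemma SUP_abs_nderiv_nonneg:
  assumes "Ck_on k T f" "j \<le> k" "0 \<le> s" "s \<le> T"
  shows "0 \<le> (SUP t\<in>{0..s}. \<bar>nderiv T j f t\<bar>)"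
  using abs_nderiv_le_SUP[OF assms(1,2,4), of 0] assms(3) by auto

theorem stiff_error_bound:
  assumes "0 < z0" and "C \<in> {C_minus..C_plus}" and "0 < h" "lam * h \<le> - z0"
    and \<phi>: "Ck_on 6 T \<phi>" and sol: "method_solution C T lam \<phi> h y" and n: "real n * h \<le> T"
  defines "\<rho> \<equiv> 1 - z0 / (2000 * (1 + z0))"
  shows "\<bar>err \<phi> h y n\<bar> \<le> \<rho> ^ n * \<bar>err \<phi> h y 0\<bar>
    + 232 / (1 - \<rho>) * (h ^ 3 / \<bar>lam\<bar> ^ 2) * (SUP t\<in>{0..real n * h}. \<bar>nderiv T 5 \<phi> t\<bar>)"
proof -
  define z where "z = lam * h"
  define M where "M = (SUP t\<in>{0..real n * h}. \<bar>nderiv T 5 \<phi> t\<bar>)"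
  note C = C_bounds[OF assms(2)]
  have z: "z < 0" "z \<le> - z0" using assms by (auto simp: z_def)
  have lam: "lam \<noteq> 0" using z by (auto simp: z_def)
  have \<rho>: "0 \<le> \<rho>" "\<rho> < 1" using assms(1) by (auto simp: \<rho>_def field_simps)
  have M0: "0 \<le> M" unfolding M_def
    by (rule SUP_abs_nderiv_nonneg[OF \<phi>]) (use assms in auto)
  define b where "b = 232 * (h ^ 3 / \<bar>lam\<bar> ^ 2) * M"
  note g = denom_ge[OF z(1) C(1)]
  have "0 < z\<^sup>2" using z by simp
  \<comment> \<open>The constant is 232 = 4 * 48 + 40.\<close>
  then have "4 / stage_denom z + 1 / step_denom C z \<le> 4 / (z\<^sup>2/48) + 1 / (z\<^sup>2/40)"
    using g by (intro add_mono divide_left_mono mult_pos_pos) auto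
  then have "4 / stage_denom z + 1 / step_denom C z \<le> 232 / z\<^sup>2" by simp
  then have "M * h^5 * (4 / stage_denom z + 1 / step_denom C z) \<le> M * h^5 * (232 / z\<^sup>2)"
    using M0 assms by (intro mult_left_mono) auto
  also have "\<dots> = b"
    using lam assms by (simp add: b_def z_def field_simps eval_nat_numeral)
  finally have b: "M * h^5 * (4 / stage_denom z + 1 / step_denom C z) \<le> b" .
  have "\<bar>err \<phi> h y n\<bar> \<le> \<rho> ^ n * \<bar>err \<phi> h y 0\<bar> + b / (1 - \<rho>)"
  proof (rule geometric_recursion_bound[OF \<rho>])
    show "0 \<le> b" unfolding b_def using M0 assms by simp
    show "\<bar>err \<phi> h y (Suc k)\<bar> \<le> \<rho> * \<bar>err \<phi> h y k\<bar> + b" if "k < n" for k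
      using err_Suc_le[OF sol z_def assms(1) z(2) \<phi> \<open>0 < h\<close> that n M_def C] b
      unfolding \<rho>_def by linarith
  qed
  then show ?thesis by (simp add: b_def M_def mult.commute)
qed

text \<open>The denominators are bounded below by 1 and the damping factor above by 1, so local
  errors of at most \<open>5 * M * h^5\<close> add up over \<open>n \<le> T / h\<close> steps, at
  the cost of one power of \<open>h\<close>.\<close>

theorem classical_error_bound:
  assumes "C \<in> {C_minus..C_plus}" and "0 < T" "0 < h" "lam < 0"
    and \<phi>: "Ck_on 6 T \<phi>" and sol: "method_solution C T lam \<phi> h y" and n: "real n * h \<le> T"
    and e0: "err \<phi> h y 0 = 0"
  shows "\<bar>err \<phi> h y n\<bar> \<le> 5 * T * (SUP t\<in>{0..T}. \<bar>nderiv T 5 \<phi> t\<bar>) * h ^ 4"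
proof -
  define z where "z = lam * h"
  define M where "M = (SUP t\<in>{0..real n * h}. \<bar>nderiv T 5 \<phi> t\<bar>)"
  define M' where "M' = (SUP t\<in>{0..T}. \<bar>nderiv T 5 \<phi> t\<bar>)"
  note C = C_bounds[OF assms(1)]
  have z: "z < 0" using assms by (auto simp: z_def mult_neg_pos)
  have M0: "0 \<le> M" unfolding M_def
    by (rule SUP_abs_nderiv_nonneg[OF \<phi>]) (use assms in auto)
  have MM': "M \<le> M'" unfolding M_def M'_def
    using n assms by (intro cSUP_subset_mono bdd_above_abs_nderiv[OF \<phi>]) auto
  note g = denom_ge[OF z C(1)]
  have "4 / stage_denom z + 1 / step_denom C z \<le> 4 / 1 + 1 / 1"
    using g by (intro add_mono divide_left_mono mult_pos_pos) auto
  then have b: "M * h^5 * (4 / stage_denom z + 1 / step_denom C z) \<le> M * h^5 * 5"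
    using M0 assms by (intro mult_left_mono) auto
  \<comment> \<open>This is the damping factor for \<open>z0 = - z\<close>; it tends to 1 with
    \<open>h\<close> and is discarded.\<close>
  have contr: "(1 - (- z) / (2000 * (1 + (- z)))) * \<bar>e\<bar> \<le> \<bar>e\<bar>" for e :: real
    using z by (intro mult_left_le_one_le) (auto simp: field_simps)
  have "\<bar>err \<phi> h y k\<bar> \<le> real k * (M * h^5 * 5)" if "k \<le> n" for k
    using that
  proof (induction k)
    case (Suc k)
    have zz: "0 < - z" "z \<le> - (- z)" using z by auto
    have "\<bar>err \<phi> h y (Suc k)\<bar> \<le> \<bar>err \<phi> h y k\<bar> + M * h^5 * 5"
      using err_Suc_le[OF sol z_def zz \<phi> \<open>0 < h\<close> _ n M_def C, of k] b Suc.prems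
        contr[of "err \<phi> h y k"] by linarith
    then show ?case using Suc by (simp add: algebra_simps)
  qed (simp add: e0)
  then have "\<bar>err \<phi> h y n\<bar> \<le> (real n * h) * (M * (5 * h^4))"
    by (simp add: eval_nat_numeral mult_ac)
  also have "\<dots> \<le> T * (M' * (5 * h^4))"
    using n MM' M0 assms by (intro mult_mono) auto
  finally show ?thesis by (simp add: M'_def mult_ac)
qed

theorem theorem3:
  fixes z0 C :: real
  assumes "0 < z0" and "C \<in> {C_minus..C_plus}"
  shows "(\<exists>\<rho> K1 K2 :: real. 0 \<le> \<rho> \<and> \<rho> < 1 \<and>
      (\<forall>(T::real) (lam::real) (h::real) (\<phi>::real \<Rightarrow> real) (y::nat \<Rightarrow> real).
         0 < T \<longrightarrow> lam < 0 \<longrightarrow> 0 < h \<longrightarrow> lam * h \<le> - z0 \<longrightarrow> Ck_on 6 T \<phi> \<longrightarrow>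
         method_solution C T lam \<phi> h y \<longrightarrow>
         (\<forall>n. real n * h \<le> T \<longrightarrow>
            \<bar>err \<phi> h y n\<bar> \<le> \<rho> ^ n * \<bar>err \<phi> h y 0\<bar>
              + K1 / (1 - \<rho>) * (h ^ 3 / \<bar>lam\<bar> ^ 2) * (SUP t\<in>{0..real n * h}. \<bar>nderiv T 5 \<phi> t\<bar>)
              + K2 / (1 - \<rho>) * h ^ 6 * (SUP t\<in>{0..real n * h}. \<bar>nderiv T 6 \<phi> t\<bar>)) \<and>
         (err \<phi> h y 0 = 0 \<longrightarrow>
          (\<forall>n. real n * h \<le> T \<longrightarrow>
            \<bar>err \<phi> h y n\<bar>
              \<le> K1 / (1 - \<rho>) * (h ^ 3 / \<bar>lam\<bar> ^ 2) * (SUP t\<in>{0..real n * h}. \<bar>nderiv T 5 \<phi> t\<bar>)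
              + K2 / (1 - \<rho>) * h ^ 6 * (SUP t\<in>{0..real n * h}. \<bar>nderiv T 6 \<phi> t\<bar>)))))
    \<and> (\<forall>(T::real) (lam::real) (\<phi>::real \<Rightarrow> real) (Y::real \<Rightarrow> nat \<Rightarrow> real).
         0 < T \<longrightarrow> lam < 0 \<longrightarrow> Ck_on 6 T \<phi> \<longrightarrow>
         (\<forall>h>0. method_solution C T lam \<phi> h (Y h) \<and> err \<phi> h (Y h) 0 = 0) \<longrightarrow>
         (\<lambda>h. Max ((\<lambda>n. \<bar>err \<phi> h (Y h) n\<bar>) ` {n. real n * h \<le> T})) \<in> O[at_right 0](\<lambda>h. h ^ 4))"
  (is "?stiff \<and> ?classical")
proof
  define \<rho> where "\<rho> = 1 - z0 / (2000 * (1 + z0))"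
  have "0 \<le> \<rho>" "\<rho> < 1" using assms(1) by (auto simp: \<rho>_def field_simps)
  then show ?stiff
    using stiff_error_bound[OF assms, folded \<rho>_def]
    by (intro exI[of _ \<rho>] exI[of _ 232] exI[of _ 0]) fastforce
next
  show ?classical
  proof (intro allI impI)
    fix T lam :: real and \<phi> :: "real \<Rightarrow> real" and Y :: "real \<Rightarrow> nat \<Rightarrow> real"
    assume T: "0 < T" "lam < 0" "Ck_on 6 T \<phi>"
      and Y: "\<forall>h>0. method_solution C T lam \<phi> h (Y h) \<and> err \<phi> h (Y h) 0 = 0"
    define B where "B = 5 * T * (SUP t\<in>{0..T}. \<bar>nderiv T 5 \<phi> t\<bar>)"
    \<comment> \<open>The bound holds for every positive \<open>h\<close>, so the Landau estimate
      needs no threshold.\<close>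
    have "norm (Max ((\<lambda>n. \<bar>err \<phi> h (Y h) n\<bar>) ` {n. real n * h \<le> T})) \<le> B * norm (h ^ 4)"
      if h: "0 < h" for h
    proof -
      let ?A = "(\<lambda>n. \<bar>err \<phi> h (Y h) n\<bar>) ` {n. real n * h \<le> T}"
      \<comment> \<open>\<open>Max\<close> is meaningful only on a finite nonempty set; the index 0
        always belongs to it.\<close>
      have "{n. real n * h \<le> T} \<subseteq> {..nat \<lfloor>T / h\<rfloor>}"
        using h by (auto simp: le_nat_floor pos_le_divide_eq)
      then have fin: "finite ?A" by (meson finite_atMost finite_imageI finite_subset)
      have ne: "0 \<in> {n. real n * h \<le> T}" using T by simp
      then have "0 \<le> Max ?A"
        by (intro order_trans[OF abs_ge_zero Max_ge[OF fin]]) (rule imageI)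
      moreover have "Max ?A \<le> B * h ^ 4"
      proof (rule Max.boundedI[OF fin])
        show "?A \<noteq> {}" using ne by blast
      qed (use T Y h classical_error_bound[OF assms(2)] in \<open>auto simp: B_def\<close>)
      ultimately show ?thesis using h by simp
    qed
    then show "(\<lambda>h. Max ((\<lambda>n. \<bar>err \<phi> h (Y h) n\<bar>) ` {n. real n * h \<le> T})) \<in> O[at_right 0](\<lambda>h. h ^ 4)"
      by (intro bigoI[of _ B]) (auto simp: eventually_at_right_less intro!: eventually_mono[OF eventually_at_right_less])
  qed
qed

end
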